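(* Let $2<p<\infty$ and let $X$ be either $L^p[0,1]$ or $\ell_p$. Then: (i) there is no constant $K<\infty$ such that $\gamma_2(\operatorname{conv}T;X)\le K\sqrt{\log|T|}$ for every nonempty finite set $T\subseteq B_X$; (ii) there is no constant $K<\infty$ such that $\gamma_2(\operatorname{conv}T;X)\le K\,\gamma_2(T;X)$ for every nonempty finite set $T\subseteq X$.
   Context: All Banach spaces are real; $B_X$ is the closed unit ball of $X$, $\log$ is the natural logarithm, and $[0,1]$ carries Lebesgue measure. An admissible sequence on a metric space $(K,d)$ is a refining sequence of partitions $(\mathcal A_n)_{n\ge0}$ of $K$ (each $\mathcal A_{n+1}$ refines $\mathcal A_n$) such that $|\mathcal A_0|=1$ and $|\mathcal A_n|\le2^{2^n}$ for $n\ge1$. For $x\in K$, $\mathcal A_n(x)$ is the element of $\mathcal A_n$ containing $x$. Define \[ \gamma_2(K,d)=\inf_{(\mathcal A_n)}\sup_{x\in K}\sum_{n\ge0}2^{n/2}\operatorname{diam}\bigl(\mathcal A_n(x)\bigr), \] the infimum being over all admissible sequences. For a subset $K$ of a Banach space $X$, $\gamma_2(K;X)$ is $\gamma_2(K,d)$ with $d$ the metric induced by the norm of $X$. $\operatorname{conv}T$ is the convex hull of $T$. *)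

theory Defs
  imports "HOL-Analysis.Analysis" "HOL-Library.Function_Algebras" "HOL-Library.Disjoint_Sets"
begin

section \<open>The functional \<open>\<gamma>\<^sub>2\<close>\<close>

text \<open>Extended values are used so that neither the supremum nor the infinite sum in
  \<open>\<gamma>\<^sub>2\<close> depends on a convention for divergence.\<close>

definition ediam :: "('a \<Rightarrow> 'a \<Rightarrow> real) \<Rightarrow> 'a set \<Rightarrow> ennreal" where
  "ediam d A = (SUP x\<in>A. SUP y\<in>A. ennreal (d x y))"

definition admissible :: "'a set \<Rightarrow> (nat \<Rightarrow> 'a set set) \<Rightarrow> bool" where
  "admissible K \<A> \<longleftrightarrow>
     (\<forall>n. partition_on K (\<A> n)) \<and>
     (\<forall>n. refines K (\<A> (Suc n)) (\<A> n)) \<and>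
     card (\<A> 0) = 1 \<and>
     (\<forall>n\<ge>1. finite (\<A> n) \<and> card (\<A> n) \<le> 2 ^ (2 ^ n))"

definition cell :: "'a set set \<Rightarrow> 'a \<Rightarrow> 'a set" where
  "cell P x = (THE A. A \<in> P \<and> x \<in> A)"

definition gamma2 :: "'a set \<Rightarrow> ('a \<Rightarrow> 'a \<Rightarrow> real) \<Rightarrow> ennreal" where
  "gamma2 K d =
     (INF \<A>\<in>{\<A>. admissible K \<A>}.
        SUP x\<in>K. \<Sum>n. ennreal (2 powr (real n / 2)) * ediam d (cell (\<A> n) x))"

text \<open>\<open>\<gamma>\<^sub>2(K; X)\<close> for a subset \<open>K\<close> of a space \<open>X\<close> with norm \<open>N\<close>. The Banach spaces below
  depend on the real parameter \<open>p\<close>, so they are sets with an explicit norm inside a fixed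
  real vector space rather than types.\<close>

definition gamma2_norm :: "('a::real_vector \<Rightarrow> real) \<Rightarrow> 'a set \<Rightarrow> ennreal" where
  "gamma2_norm N K = gamma2 K (\<lambda>x y. N (x - y))"

definition unit_ball :: "'a set \<Rightarrow> ('a \<Rightarrow> real) \<Rightarrow> 'a set" where
  "unit_ball X N = {x \<in> X. N x \<le> 1}"


section \<open>The sequence space \<open>\<ell>\<^sub>p\<close>\<close>

instantiation "fun" :: (type, real_vector) real_vector
begin

definition scaleR_fun :: "real \<Rightarrow> ('a \<Rightarrow> 'b) \<Rightarrow> 'a \<Rightarrow> 'b" where
  "scaleR_fun c f = (\<lambda>x. c *\<^sub>R f x)"

instance
  by standard (auto simp: scaleR_fun_def fun_eq_iff algebra_simps)

end

definition seq_lp :: "real \<Rightarrow> (nat \<Rightarrow> real) set" where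
  "seq_lp p = {a. summable (\<lambda>n. \<bar>a n\<bar> powr p)}"

definition seq_lp_norm :: "real \<Rightarrow> (nat \<Rightarrow> real) \<Rightarrow> real" where
  "seq_lp_norm p a = (\<Sum>n. \<bar>a n\<bar> powr p) powr (1 / p)"


section \<open>The function space \<open>L\<^sup>p[0,1]\<close>\<close>

abbreviation leb01 :: "real measure" where
  "leb01 \<equiv> lebesgue_on {0..1}"

definition ae_eq01 :: "(real \<Rightarrow> real) \<Rightarrow> (real \<Rightarrow> real) \<Rightarrow> bool" where
  "ae_eq01 f g \<longleftrightarrow> f \<in> borel_measurable leb01 \<and> g \<in> borel_measurable leb01 \<and>
     (AE x in leb01. f x = g x)"

text \<open>Classes of measurable real functions on \<open>[0,1]\<close> modulo equality almost everywhere.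
  Values outside \<open>[0,1]\<close> play no role, since \<open>leb01\<close> lives on \<open>[0,1]\<close>.\<close>

quotient_type L0 = "real \<Rightarrow> real" / partial: ae_eq01
proof (rule part_equivpI)
  show "\<exists>f. ae_eq01 f f"
    by (rule exI[of _ "\<lambda>_. 0"]) (simp add: ae_eq01_def)
  show "symp ae_eq01"
    by (rule sympI) (auto simp: ae_eq01_def elim: AE_mp)
  show "transp ae_eq01"
    by (rule transpI) (auto simp: ae_eq01_def elim!: AE_mp)
qed

instantiation L0 :: real_vector
begin

lift_definition zero_L0 :: L0 is "\<lambda>_. 0"
  by (simp add: ae_eq01_def)

lift_definition plus_L0 :: "L0 \<Rightarrow> L0 \<Rightarrow> L0" is "\<lambda>f g x. f x + g x"
  by (auto simp: ae_eq01_def elim!: AE_mp)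

lift_definition uminus_L0 :: "L0 \<Rightarrow> L0" is "\<lambda>f x. - f x"
  by (auto simp: ae_eq01_def elim!: AE_mp)

lift_definition minus_L0 :: "L0 \<Rightarrow> L0 \<Rightarrow> L0" is "\<lambda>f g x. f x - g x"
  by (auto simp: ae_eq01_def elim!: AE_mp)

lift_definition scaleR_L0 :: "real \<Rightarrow> L0 \<Rightarrow> L0" is "\<lambda>c f x. c * f x"
  by (auto simp: ae_eq01_def elim!: AE_mp)

instance
  by standard (transfer, auto simp: ae_eq01_def algebra_simps)+

end

lift_definition in_Lp :: "real \<Rightarrow> L0 \<Rightarrow> bool" is
  "\<lambda>p f. integrable leb01 (\<lambda>x. \<bar>f x\<bar> powr p)"
  unfolding ae_eq01_def by (intro integrable_cong_AE) (auto elim!: AE_mp)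

lift_definition Lp_norm :: "real \<Rightarrow> L0 \<Rightarrow> real" is
  "\<lambda>p f. (\<integral>x. \<bar>f x\<bar> powr p \<partial>leb01) powr (1 / p)"
  unfolding ae_eq01_def
  by (intro arg_cong2[where f = "(powr)"] integral_cong_AE refl) (auto elim!: AE_mp)

definition Lp :: "real \<Rightarrow> L0 set" where
  "Lp p = {f. in_Lp p f}"

end

theory Submission
  imports Defs
begin

text \<open>Let \<open>J = 2\<^sup>r\<close> and let \<open>T\<close> be the product of \<open>J\<close> copies of a set of Rademacher functions indexed
  by \<open>{0..<2\<^sup>J} \<times> {0..<2\<^sup>J}\<close>, in an \<open>\<ell>\<^sub>p\<close>-sum of \<open>J\<close> copies of \<open>L\<^sup>p\<close> of the cube, normalised by
  \<open>J\<close> to the power \<open>-1/p\<close>. Then \<open>sqrt (ln |T|)\<close> and \<open>\<gamma>\<^sub>2(T)\<close> are of order at most \<open>2\<^sup>r\<close>. Averages of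
  \<open>2\<^sup>j\<close> Rademacher functions contain so many points at \<open>L\<^sup>2\<close>-distance (hence \<open>L\<^sup>p\<close>-distance, as
  \<open>p > 2\<close>) at least \<open>2 powr (- j/2)\<close> that no partition of level \<open>j + r - 2\<close> separates them.
  Since the convex hull of a product is a product, averages for all \<open>j < J\<close> occur at once in the
  coordinates of one point of \<open>conv T\<close>. So every level contributes \<open>2 powr (r/2 - 1 - r/p)\<close>
  to \<open>\<gamma>\<^sub>2(conv T)\<close>, which is therefore at least of order \<open>2 powr (r (3/2 - 1/p))\<close>, and
  \<open>3/2 - 1/p > 1\<close>.\<close>

section \<open>Bounds for \<open>\<gamma>\<^sub>2\<close>\<close>

lemma cell_eqI:
  assumes "partition_on K P" "A \<in> P" "x \<in> A"
  shows "cell P x = A"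
  unfolding cell_def
proof (rule the_equality)
  fix B assume "B \<in> P \<and> x \<in> B"
  then show "B = A"
    using assms disjointD[OF partition_onD2[OF assms(1)], of B A] by auto
qed (use assms in simp)

lemma cell_props:
  assumes P: "partition_on K P" and x: "x \<in> K"
  shows "cell P x \<in> P" "x \<in> cell P x"
proof -
  obtain A where A: "A \<in> P" "x \<in> A"
    using x unfolding partition_onD1[OF P] by auto
  with cell_eqI[OF P A] show "cell P x \<in> P" "x \<in> cell P x"
    by simp_all
qed

lemma ediam_ge:
  assumes "x \<in> A" "y \<in> A"
  shows "ennreal (d x y) \<le> ediam d A"
  unfolding ediam_def using assms by (meson SUP_upper2 order_refl)

lemma sum_le_suminf_ennreal:
  fixes f :: "nat \<Rightarrow> ennreal"
  assumes "finite I" "inj_on \<nu> I"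
  shows "(\<Sum>j\<in>I. f (\<nu> j)) \<le> (\<Sum>n. f n)"
proof -
  have "(\<Sum>j\<in>I. f (\<nu> j)) = sum f (\<nu> ` I)"
    using assms by (simp add: sum.reindex)
  also have "\<dots> \<le> (\<Sum>n. f n)"
    using assms by (intro sum_le_suminf) auto
  finally show ?thesis .
qed

text \<open>If the coordinate \<open>F j\<close> ranges over so many points that cells of the partition of level
  \<open>\<nu> j\<close> and ``balls'' of points that are not far from each other cannot cover them, then by a union
  bound one point of the product is bad for all levels at once.\<close>

lemma exists_point_all_cells_large:
  fixes S :: "'j \<Rightarrow> 'c set" and y :: "('j \<Rightarrow> 'c) \<Rightarrow> 'a"
  assumes adm: "admissible K \<A>"
    and J: "finite J"
    and S: "\<And>j. j \<in> J \<Longrightarrow> finite (S j)"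
    and y: "\<And>F. F \<in> Pi\<^sub>E J S \<Longrightarrow> y F \<in> K"
    and \<nu>: "\<And>j. j \<in> J \<Longrightarrow> 1 \<le> \<nu> j"
    and far: "\<And>j F G. j \<in> J \<Longrightarrow> F \<in> Pi\<^sub>E J S \<Longrightarrow> G \<in> Pi\<^sub>E J S \<Longrightarrow> far j (F j) (G j)
                \<Longrightarrow> \<delta> j \<le> d (y F) (y G)"
    and ball: "\<And>j f. j \<in> J \<Longrightarrow> f \<in> S j \<Longrightarrow> card {g\<in>S j. \<not> far j f g} \<le> b j"
    and big: "\<And>j. j \<in> J \<Longrightarrow> card J * (2 ^ 2 ^ \<nu> j * b j) < card (S j)"
  obtains F where "F \<in> Pi\<^sub>E J S" "\<And>j. j \<in> J \<Longrightarrow> ennreal (\<delta> j) \<le> ediam d (cell (\<A> (\<nu> j)) (y F))"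
proof -
  define G where "G = Pi\<^sub>E J S"
  have finG: "finite G"
    unfolding G_def using J S by (intro finite_PiE) auto
  have part: "partition_on K (\<A> n)" for n
    using adm by (simp add: admissible_def)
  define bad where "bad j = {F\<in>G. ediam d (cell (\<A> (\<nu> j)) (y F)) < ennreal (\<delta> j)}" for j
  have S_pos: "card (S j) > 0" if "j \<in> J" for j
    using big[OF that] by simp
  have card_G: "card G = (\<Prod>j\<in>J. card (S j))"
    unfolding G_def using J by (rule card_PiE)
  have G_pos: "card G > 0"
    unfolding card_G using S_pos by (intro prod_pos) auto
  \<comment> \<open>Members of \<open>bad j\<close> sharing a cell are not far from each other in
    coordinate \<open>j\<close>. Fixing one of them, \<open>F0\<close>, confines that coordinate to
    a ball and leaves the others free. The resulting share \<open>b j / card (S j)\<close> of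
    \<open>G\<close> is stated multiplied out, to stay in the naturals.\<close>
  have cell_bad: "card {F\<in>bad j. cell (\<A> (\<nu> j)) (y F) = A} * card (S j) \<le> b j * card G"
    if j: "j \<in> J" for j A
  proof (cases "{F\<in>bad j. cell (\<A> (\<nu> j)) (y F) = A} = {}")
    case True
    then show ?thesis by (simp only: card.empty)
  next
    case False
    then obtain F0 where F0: "F0 \<in> bad j" "cell (\<A> (\<nu> j)) (y F0) = A"
      by blast
    have F0G: "F0 \<in> G" using F0 by (simp add: bad_def)
    have sub: "{F\<in>bad j. cell (\<A> (\<nu> j)) (y F) = A} \<subseteq> Pi\<^sub>E J (S(j := {g\<in>S j. \<not> far j (F0 j) g}))"
    proof
      fix F assume F: "F \<in> {F\<in>bad j. cell (\<A> (\<nu> j)) (y F) = A}"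
      then have FG: "F \<in> G" by (simp add: bad_def)
      have "y F \<in> K" "y F0 \<in> K"
        using FG F0G y by (auto simp: G_def)
      then have "y F \<in> A" "y F0 \<in> A"
        using cell_props(2)[OF part] F F0 by auto
      then have "ennreal (d (y F0) (y F)) \<le> ediam d A"
        by (intro ediam_ge)
      also have "\<dots> < ennreal (\<delta> j)"
        using F0 by (auto simp: bad_def)
      finally have "\<not> \<delta> j \<le> d (y F0) (y F)"
        using ennreal_leI leD by blast
      then have "\<not> far j (F0 j) (F j)"
        using far[OF j, of F0 F] FG F0G by (auto simp: G_def)
      then show "F \<in> Pi\<^sub>E J (S(j := {g\<in>S j. \<not> far j (F0 j) g}))"
        using FG unfolding G_def by (auto simp: PiE_iff)
    qed
    have "card {F\<in>bad j. cell (\<A> (\<nu> j)) (y F) = A}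
        \<le> card (Pi\<^sub>E J (S(j := {g\<in>S j. \<not> far j (F0 j) g})))"
      using sub J S by (intro card_mono finite_PiE) auto
    also have "\<dots> = (\<Prod>i\<in>J. card ((S(j := {g\<in>S j. \<not> far j (F0 j) g})) i))"
      using J by (rule card_PiE)
    also have "\<dots> = card {g\<in>S j. \<not> far j (F0 j) g} * (\<Prod>i\<in>J-{j}. card (S i))"
      using J j by (subst prod.remove[of _ j]) (auto intro!: prod.cong)
    also have "\<dots> \<le> b j * (\<Prod>i\<in>J-{j}. card (S i))"
      using ball[OF j, of "F0 j"] F0G j by (intro mult_right_mono) (auto simp: G_def)
    finally have "card {F\<in>bad j. cell (\<A> (\<nu> j)) (y F) = A} * card (S j)
        \<le> b j * (\<Prod>i\<in>J-{j}. card (S i)) * card (S j)"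
      by (rule mult_right_mono) simp
    also have "\<dots> = b j * card G"
      unfolding card_G using J j by (subst (2) prod.remove[of _ j]) auto
    finally show ?thesis .
  qed
  \<comment> \<open>At most \<open>2 ^ 2 ^ \<nu> j\<close> cells occur, so by \<open>big\<close>
    each bad set makes up less than a fraction \<open>1 / card J\<close> of
    \<open>G\<close>.\<close>
  have bad_small: "card J * card (bad j) < card G" if j: "j \<in> J" for j
  proof -
    have fin: "finite (\<A> (\<nu> j))" and cd: "card (\<A> (\<nu> j)) \<le> 2 ^ 2 ^ \<nu> j"
      using adm \<nu>[OF j] by (auto simp: admissible_def)
    have "bad j \<subseteq> (\<Union>A\<in>\<A> (\<nu> j). {F\<in>bad j. cell (\<A> (\<nu> j)) (y F) = A})"
      using cell_props(1)[OF part] y by (auto simp: bad_def G_def)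
    then have "card (bad j) \<le> card (\<Union>A\<in>\<A> (\<nu> j). {F\<in>bad j. cell (\<A> (\<nu> j)) (y F) = A})"
      using fin finG by (intro card_mono) (auto simp: bad_def)
    also have "\<dots> \<le> (\<Sum>A\<in>\<A> (\<nu> j). card {F\<in>bad j. cell (\<A> (\<nu> j)) (y F) = A})"
      using fin by (rule card_UN_le)
    finally have "card (bad j) \<le> (\<Sum>A\<in>\<A> (\<nu> j). card {F\<in>bad j. cell (\<A> (\<nu> j)) (y F) = A})" .
    then have "card (bad j) * card (S j)
        \<le> (\<Sum>A\<in>\<A> (\<nu> j). card {F\<in>bad j. cell (\<A> (\<nu> j)) (y F) = A}) * card (S j)"
      by (rule mult_right_mono) simp
    also have "\<dots> \<le> (\<Sum>A\<in>\<A> (\<nu> j). b j * card G)"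
      unfolding sum_distrib_right using cell_bad[OF j] by (intro sum_mono)
    also have "\<dots> \<le> 2 ^ 2 ^ \<nu> j * (b j * card G)"
      using cd by simp
    finally have *: "card (bad j) * card (S j) \<le> 2 ^ 2 ^ \<nu> j * (b j * card G)" .
    have "card J * card (bad j) * card (S j) \<le> card J * (2 ^ 2 ^ \<nu> j * b j) * card G"
      using mult_left_mono[OF *, of "card J"] by (simp add: mult_ac)
    also have "\<dots> < card (S j) * card G"
      using big[OF j] G_pos by (intro mult_strict_right_mono)
    finally have "card J * card (bad j) * card (S j) < card G * card (S j)"
      by (simp only: mult.commute)
    then show ?thesis
      using mult_less_cancel2 by blast
  qed
  have "card (\<Union>j\<in>J. bad j) < card G"
  proof (cases "J = {}")
    case True
    then show ?thesis using G_pos by simp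
  next
    case False
    have "card J * card (\<Union>j\<in>J. bad j) \<le> card J * (\<Sum>j\<in>J. card (bad j))"
      using card_UN_le[OF J] by (intro mult_left_mono) auto
    also have "\<dots> < (\<Sum>j\<in>J. card G)"
      unfolding sum_distrib_left using bad_small False J by (intro sum_strict_mono) auto
    finally show ?thesis by simp
  qed
  then have "\<not> G \<subseteq> (\<Union>j\<in>J. bad j)"
    using card_mono[of "\<Union>j\<in>J. bad j" G] J finG by (auto simp: bad_def)
  then obtain F where "F \<in> G" "\<And>j. j \<in> J \<Longrightarrow> F \<notin> bad j"
    by blast
  then show ?thesis
    using that[of F] by (auto simp: bad_def G_def not_less)
qed

lemma gamma2_geI:
  assumes "\<And>\<A>. admissible K \<A> \<Longrightarrow>
     \<exists>x\<in>K. B \<le> (\<Sum>n. ennreal (2 powr (real n / 2)) * ediam d (cell (\<A> n) x))"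
  shows "B \<le> gamma2 K d"
  unfolding gamma2_def using assms by (intro INF_greatest) (auto intro: SUP_upper2)

text \<open>The partition is trivial below level \<open>m\<close> and passes to singletons at level
  \<open>m\<close>, where the bound on \<open>card T\<close> permits it. Only the levels below
  \<open>m\<close> contribute, each with diameter at most \<open>D\<close>; \<open>1 \<le> m\<close>
  keeps level 0 a single cell.\<close>

lemma gamma2_le_of_card_le:
  fixes d :: "'a \<Rightarrow> 'a \<Rightarrow> real"
  assumes T: "finite T" "T \<noteq> {}" and card: "card T \<le> 2 ^ 2 ^ m" and m: "1 \<le> m"
    and d0: "\<And>x. x \<in> T \<Longrightarrow> d x x = 0"
    and D: "\<And>x y. x \<in> T \<Longrightarrow> y \<in> T \<Longrightarrow> d x y \<le> D"
  shows "gamma2 T d \<le> ennreal (\<Sum>n<m. 2 powr (real n / 2)) * ennreal D"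
proof -
  define \<A> where "\<A> n = (if n < m then {T} else (\<lambda>x. {x}) ` T)" for n
  have part: "partition_on T (\<A> n)" for n
    using T by (simp add: \<A>_def partition_on_space partition_on_singletons)
  have "refines T (\<A> (Suc n)) (\<A> n)" for n
    using part[of n] part[of "Suc n"] by (auto simp: refines_def \<A>_def)
  moreover have "card (\<A> 0) = 1"
    using m by (simp add: \<A>_def)
  moreover have "finite (\<A> n) \<and> card (\<A> n) \<le> 2 ^ 2 ^ n" for n
  proof (cases "n < m")
    case False
    then have "card (\<A> n) \<le> 2 ^ 2 ^ m"
      using card card_image_le[OF T(1), of "\<lambda>x. {x}"] by (simp add: \<A>_def)
    also have "\<dots> \<le> 2 ^ 2 ^ n"
      using False by (intro power_increasing) auto
    finally show ?thesis using T by (simp add: \<A>_def)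
  qed (simp add: \<A>_def)
  ultimately have adm: "admissible T \<A>"
    using part by (auto simp: admissible_def)
  have "(\<Sum>n. ennreal (2 powr (real n / 2)) * ediam d (cell (\<A> n) x))
      \<le> ennreal (\<Sum>n<m. 2 powr (real n / 2)) * ennreal D" if x: "x \<in> T" for x
  proof -
    have 1: "ediam d (cell (\<A> n) x) \<le> ennreal D" if "n < m" for n
    proof -
      have "cell (\<A> n) x = T"
        using that x by (intro cell_eqI[OF part]) (auto simp: \<A>_def)
      then show ?thesis
        unfolding ediam_def using D by (auto intro!: SUP_least ennreal_leI)
    qed
    have 2: "ediam d (cell (\<A> n) x) = 0" if "\<not> n < m" for n
    proof -
      have "cell (\<A> n) x = {x}"
        using that x by (intro cell_eqI[OF part]) (auto simp: \<A>_def)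
      then show ?thesis
        using d0 x by (simp add: ediam_def)
    qed
    have "(\<Sum>n. ennreal (2 powr (real n / 2)) * ediam d (cell (\<A> n) x))
        = (\<Sum>n<m. ennreal (2 powr (real n / 2)) * ediam d (cell (\<A> n) x))"
      using 2 by (intro suminf_finite) auto
    also have "\<dots> \<le> (\<Sum>n<m. ennreal (2 powr (real n / 2)) * ennreal D)"
      using 1 by (intro sum_mono mult_left_mono) auto
    also have "\<dots> = ennreal (\<Sum>n<m. 2 powr (real n / 2)) * ennreal D"
      by (subst sum_distrib_right[symmetric], subst sum_ennreal) auto
    finally show ?thesis .
  qed
  then show ?thesis
    unfolding gamma2_def using adm by (intro INF_lower2[of \<A>]) (auto intro: SUP_least)
qed


section \<open>Rademacher functions\<close>

text \<open>Jensen's inequality for \<open>t powr (p / 2)\<close>: the tangent at 1 is summed over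
  the values \<open>(z x)\<^sup>2 / m\<^sup>2\<close>, whose mean is 1, so the linear bounds add up
  to \<open>card A\<close>.\<close>

lemma power_mean:
  fixes z :: "'a \<Rightarrow> real"
  assumes A: "finite A" "A \<noteq> {}" and p: "2 \<le> p" and m: "0 \<le> m"
    and m2: "(\<Sum>x\<in>A. (z x)\<^sup>2) = real (card A) * m\<^sup>2"
  shows "real (card A) * m powr p \<le> (\<Sum>x\<in>A. \<bar>z x\<bar> powr p)"
\<comment> \<open>The main case divides by \<open>m\<close> and needs an exponent
  \<open>p / 2\<close> above 1 for Young's inequality.\<close>
proof (cases "m = 0 \<or> p = 2")
  case True
  then show ?thesis
  proof
    assume "m = 0"
    then show ?thesis by (simp add: sum_nonneg)
  next
    assume "p = 2"
    then show ?thesis using m2 m by simp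
  qed
next
  case False
  then have m: "m > 0" and p: "p > 2" using assms by auto
  define \<alpha> where "\<alpha> = p / 2"
  define \<beta> where "\<beta> = \<alpha> / (\<alpha> - 1)"
  have \<alpha>: "\<alpha> > 1" using p by (simp add: \<alpha>_def)
  then have \<beta>: "\<beta> > 1" "1 / \<alpha> + 1 / \<beta> = 1" by (auto simp: \<beta>_def field_simps)
  \<comment> \<open>the tangent line of \<open>t powr \<alpha>\<close> at \<open>t = 1\<close>\<close>
  have tangent: "t powr \<alpha> \<ge> \<alpha> * t - (\<alpha> - 1)" if "t \<ge> 0" for t
  proof -
    have "t \<le> t powr \<alpha> / \<alpha> + (\<alpha> - 1) / \<alpha>"
      using Youngs_inequality[OF \<alpha> \<beta> that, of 1] by (simp add: \<beta>_def)
    from mult_left_mono[OF this, of \<alpha>] show ?thesis using \<alpha> by (simp add: distrib_left)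
  qed
  have "real (card A) = \<alpha> * real (card A) - (\<alpha> - 1) * real (card A)"
    by (simp add: algebra_simps)
  also have "\<alpha> * real (card A) = \<alpha> / m\<^sup>2 * (\<Sum>x\<in>A. (z x)\<^sup>2)"
    unfolding m2 using m by simp
  also have "\<alpha> / m\<^sup>2 * (\<Sum>x\<in>A. (z x)\<^sup>2) - (\<alpha> - 1) * real (card A)
      = (\<Sum>x\<in>A. \<alpha> * ((z x)\<^sup>2 / m\<^sup>2) - (\<alpha> - 1))"
    by (simp add: sum_subtractf sum_distrib_left sum_divide_distrib)
  also have "\<dots> \<le> (\<Sum>x\<in>A. ((z x)\<^sup>2 / m\<^sup>2) powr \<alpha>)"
    by (intro sum_mono tangent) simp
  also have "\<dots> = (\<Sum>x\<in>A. \<bar>z x\<bar> powr p / m powr p)"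
  proof (rule sum.cong)
    fix x
    have "(z x)\<^sup>2 / m\<^sup>2 = (\<bar>z x\<bar> / m) powr 2"
      using m by (simp add: power_divide)
    then have "((z x)\<^sup>2 / m\<^sup>2) powr \<alpha> = (\<bar>z x\<bar> / m) powr p"
      by (simp only: powr_powr) (simp add: \<alpha>_def)
    then show "((z x)\<^sup>2 / m\<^sup>2) powr \<alpha> = \<bar>z x\<bar> powr p / m powr p"
      using m by (simp add: powr_divide)
  qed simp
  also have "\<dots> = (\<Sum>x\<in>A. \<bar>z x\<bar> powr p) / m powr p"
    by (simp add: sum_divide_distrib)
  finally show ?thesis
    using m by (simp add: field_simps)
qed

text \<open>A choice of signs on \<open>P\<close> is encoded as the subset of \<open>P\<close> where the sign is \<open>1\<close>.\<close>

definition rad :: "'a \<Rightarrow> 'a set \<Rightarrow> real" where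
  "rad u \<omega> = (if u \<in> \<omega> then 1 else -1)"

text \<open>Orthogonality: for \<open>u \<noteq> v\<close>, toggling the membership of
  \<open>u\<close> is an involution of \<open>Pow P\<close> that reverses the sign of the
  product.\<close>

lemma sum_rad_mult:
  assumes P: "finite P" and u: "u \<in> P" and v: "v \<in> P"
  shows "(\<Sum>\<omega>\<in>Pow P. rad u \<omega> * rad v \<omega>) = (if u = v then 2 ^ card P else 0)"
proof (cases "u = v")
  case True
  then have "(\<Sum>\<omega>\<in>Pow P. rad u \<omega> * rad v \<omega>) = (\<Sum>\<omega>\<in>Pow P. 1)"
    by (intro sum.cong) (auto simp: rad_def)
  then show ?thesis using True P by (simp add: card_Pow)
next
  case False
  let ?flip = "\<lambda>\<omega>. if u \<in> \<omega> then \<omega> - {u} else insert u \<omega>"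
  have "(\<Sum>\<omega>\<in>Pow P. rad u \<omega> * rad v \<omega>) = (\<Sum>\<omega>\<in>Pow P. - (rad u \<omega> * rad v \<omega>))"
    by (rule sum.reindex_bij_witness[of _ ?flip ?flip]) (use False u in \<open>auto simp: rad_def\<close>)
  then show ?thesis using False by (simp add: sum_negf)
qed

text \<open>After expanding the square, terms with \<open>i \<noteq> k\<close> vanish by
  orthogonality, because the first components of the indices differ. A diagonal term is the square
  of a difference of two orthogonal functions, or zero if \<open>f i = g i\<close>.\<close>

lemma sum_rad_diff_square:
  fixes f g :: "nat \<Rightarrow> 'v"
  assumes P: "finite P" and f: "\<And>i. i < s \<Longrightarrow> (i, f i) \<in> P" and g: "\<And>i. i < s \<Longrightarrow> (i, g i) \<in> P"
  shows "(\<Sum>\<omega>\<in>Pow P. (\<Sum>i<s. rad (i, f i) \<omega> - rad (i, g i) \<omega>)\<^sup>2)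
     = 2 ^ card P * (2 * real (card {i. i < s \<and> f i \<noteq> g i}))"
proof -
  let ?D = "\<lambda>i \<omega>. rad (i, f i) \<omega> - rad (i, g i) \<omega>"
  have "(\<Sum>\<omega>\<in>Pow P. (\<Sum>i<s. ?D i \<omega>)\<^sup>2) = (\<Sum>\<omega>\<in>Pow P. \<Sum>i<s. \<Sum>k<s. ?D i \<omega> * ?D k \<omega>)"
    by (simp add: power2_eq_square sum_product)
  also have "\<dots> = (\<Sum>i<s. \<Sum>\<omega>\<in>Pow P. \<Sum>k<s. ?D i \<omega> * ?D k \<omega>)"
    by (rule sum.swap)
  also have "\<dots> = (\<Sum>i<s. \<Sum>k<s. \<Sum>\<omega>\<in>Pow P. ?D i \<omega> * ?D k \<omega>)"
    by (intro sum.cong refl sum.swap)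
  also have "\<dots> = (\<Sum>i<s. \<Sum>k<s. if k = i then (if f i \<noteq> g i then 2 * 2 ^ card P else 0) else 0)"
  proof (intro sum.cong refl)
    fix i k assume ik: "i \<in> {..<s}" "k \<in> {..<s}"
    have "?D i \<omega> * ?D k \<omega> = rad (i, f i) \<omega> * rad (k, f k) \<omega> - rad (i, f i) \<omega> * rad (k, g k) \<omega>
        - rad (i, g i) \<omega> * rad (k, f k) \<omega> + rad (i, g i) \<omega> * rad (k, g k) \<omega>" for \<omega>
      by (simp add: algebra_simps)
    then show "(\<Sum>\<omega>\<in>Pow P. ?D i \<omega> * ?D k \<omega>)
        = (if k = i then (if f i \<noteq> g i then 2 * 2 ^ card P else 0) else 0)"
      using ik f g by (simp add: sum.distrib sum_subtractf sum_rad_mult[OF P])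
  qed
  also have "\<dots> = (\<Sum>i<s. if f i \<noteq> g i then 2 * 2 ^ card P else 0)"
    by simp
  also have "\<dots> = (\<Sum>i\<in>{i. i < s \<and> f i \<noteq> g i}. 2 * 2 ^ card P)"
    by (subst sum.inter_filter[symmetric]) (auto intro!: sum.cong)
  finally show ?thesis by simp
qed

text \<open>If \<open>f\<close> and \<open>g\<close> differ in at least half of the positions, the
  quadratic mean of the sum is at least \<open>sqrt s\<close>; the mean of order \<open>p\<close>
  dominates it.\<close>

lemma sum_rad_diff_powr_ge:
  fixes f g :: "nat \<Rightarrow> 'v"
  assumes P: "finite P" and f: "\<And>i. i < s \<Longrightarrow> (i, f i) \<in> P" and g: "\<And>i. i < s \<Longrightarrow> (i, g i) \<in> P"
    and far: "s \<le> 2 * card {i. i < s \<and> f i \<noteq> g i}" and p: "2 \<le> p"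
  shows "2 ^ card P * sqrt (real s) powr p
     \<le> (\<Sum>\<omega>\<in>Pow P. \<bar>\<Sum>i<s. rad (i, f i) \<omega> - rad (i, g i) \<omega>\<bar> powr p)"
proof -
  let ?h = "real (card {i. i < s \<and> f i \<noteq> g i})"
  have "sqrt (real s) powr p \<le> sqrt (2 * ?h) powr p"
    using far p by (intro powr_mono2) (auto simp flip: of_nat_mult)
  then have "2 ^ card P * sqrt (real s) powr p \<le> real (card (Pow P)) * sqrt (2 * ?h) powr p"
    using P by (simp add: card_Pow)
  also have "\<dots> \<le> (\<Sum>\<omega>\<in>Pow P. \<bar>\<Sum>i<s. rad (i, f i) \<omega> - rad (i, g i) \<omega>\<bar> powr p)"
    using P p by (intro power_mean) (auto simp: sum_rad_diff_square[OF P f g] card_Pow)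
  finally show ?thesis .
qed

text \<open>Such a \<open>g\<close> is determined by the set \<open>D\<close> where it differs from
  \<open>f\<close> and by its values there. There are at most \<open>2 ^ s\<close> sets
  \<open>D\<close>, and \<open>2 * card D \<le> s\<close> leaves at most
  \<open>2 ^ ((L div 2) * s)\<close> choices of values.\<close>

lemma card_hamming_ball_le:
  assumes "even L" "f \<in> {..<s} \<rightarrow>\<^sub>E {..<(2::nat) ^ L}"
  shows "card {g \<in> {..<s} \<rightarrow>\<^sub>E {..<(2::nat) ^ L}. \<not> s \<le> 2 * card {i. i < s \<and> f i \<noteq> g i}}
     \<le> 2 ^ (s + (L div 2) * s)"
proof -
  let ?B = "\<lambda>D. Pi\<^sub>E {..<s} (\<lambda>i. if i \<in> D then {..<(2::nat) ^ L} else {f i})"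
  let ?Ds = "{D\<in>Pow {..<s}. 2 * card D \<le> s}"
  have fin: "finite ?Ds" by simp
  have "{g \<in> {..<s} \<rightarrow>\<^sub>E {..<(2::nat) ^ L}. \<not> s \<le> 2 * card {i. i < s \<and> f i \<noteq> g i}} \<subseteq> (\<Union>D\<in>?Ds. ?B D)"
  proof
    fix g assume g: "g \<in> {g \<in> {..<s} \<rightarrow>\<^sub>E {..<(2::nat) ^ L}. \<not> s \<le> 2 * card {i. i < s \<and> f i \<noteq> g i}}"
    then have "{i. i < s \<and> f i \<noteq> g i} \<in> ?Ds" by auto
    moreover have "g \<in> ?B {i. i < s \<and> f i \<noteq> g i}"
      using g by (auto simp: PiE_iff)
    ultimately show "g \<in> (\<Union>D\<in>?Ds. ?B D)" by blast
  qed
  then have "card {g \<in> {..<s} \<rightarrow>\<^sub>E {..<(2::nat) ^ L}. \<not> s \<le> 2 * card {i. i < s \<and> f i \<noteq> g i}}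
      \<le> card (\<Union>D\<in>?Ds. ?B D)"
    by (intro card_mono finite_UN_I fin finite_PiE) auto
  also have "\<dots> \<le> (\<Sum>D\<in>?Ds. card (?B D))"
    using fin by (rule card_UN_le)
  also have "\<dots> \<le> (\<Sum>D\<in>?Ds. 2 ^ ((L div 2) * s))"
  proof (rule sum_mono)
    fix D assume D: "D \<in> ?Ds"
    have "card (?B D) = (\<Prod>i<s. if i \<in> D then 2 ^ L else 1)"
      by (subst card_PiE) (auto intro!: prod.cong)
    also have "\<dots> = (\<Prod>i\<in>D. 2 ^ L)"
      using D by (intro prod.mono_neutral_cong_right) auto
    also have "\<dots> = 2 ^ (L * card D)"
      by (simp add: power_mult)
    \<comment> \<open>Evenness of \<open>L\<close> makes the halving exact.\<close>
    also have "L * card D = (L div 2) * (2 * card D)"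
      using assms by auto
    also have "(2::nat) ^ \<dots> \<le> 2 ^ ((L div 2) * s)"
      using D by (intro power_increasing mult_left_mono) auto
    finally show "card (?B D) \<le> 2 ^ ((L div 2) * s)" .
  qed
  also have "\<dots> \<le> card (Pow {..<s}) * 2 ^ ((L div 2) * s)"
    by (simp, intro card_mono) auto
  also have "\<dots> = 2 ^ (s + (L div 2) * s)"
    by (simp add: card_Pow power_add)
  finally show ?thesis .
qed


section \<open>Spaces containing all finite-dimensional \<open>\<ell>\<^sub>p\<close>\<close>

text \<open>The vectors \<open>e k\<close> are the images of the unit vectors under a linear
  isometric embedding of the \<open>M\<close>-dimensional l_p space. The construction uses nothing
  else about \<open>X\<close> and \<open>N\<close>, so both spaces are treated at once.\<close>

definition contains_lp :: "real \<Rightarrow> 'a::real_vector set \<Rightarrow> ('a \<Rightarrow> real) \<Rightarrow> bool" where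
  "contains_lp p X N \<longleftrightarrow> (\<forall>M. \<exists>e :: nat \<Rightarrow> 'a. \<forall>a. (\<Sum>k<M. a k *\<^sub>R e k) \<in> X \<and>
      N (\<Sum>k<M. a k *\<^sub>R e k) = (\<Sum>k<M. \<bar>a k\<bar> powr p) powr (1 / p))"

lemma contains_lp_finite:
  fixes X :: "'a::real_vector set"
  assumes "contains_lp p X N" "finite I"
  obtains e :: "'i \<Rightarrow> 'a" where "\<And>a. (\<Sum>k\<in>I. a k *\<^sub>R e k) \<in> X"
    "\<And>a. N (\<Sum>k\<in>I. a k *\<^sub>R e k) = (\<Sum>k\<in>I. \<bar>a k\<bar> powr p) powr (1 / p)"
proof -
  obtain h where h: "bij_betw h {..<card I} I"
    using ex_bij_betw_nat_finite[OF assms(2)] by (auto simp: atLeast0LessThan)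
  obtain e :: "nat \<Rightarrow> 'a" where e: "\<And>a. (\<Sum>k<card I. a k *\<^sub>R e k) \<in> X"
    "\<And>a. N (\<Sum>k<card I. a k *\<^sub>R e k) = (\<Sum>k<card I. \<bar>a k\<bar> powr p) powr (1 / p)"
    using assms(1) unfolding contains_lp_def by blast
  define e' where "e' i = e (inv_into {..<card I} h i)" for i
  have e': "e' (h k) = e k" if "k < card I" for k
    using h that by (simp add: e'_def bij_betw_def)
  have "(\<Sum>i\<in>I. a i *\<^sub>R e' i) = (\<Sum>k<card I. a (h k) *\<^sub>R e k)" for a
    by (subst sum.reindex_bij_betw[OF h, symmetric]) (simp add: e')
  moreover have "(\<Sum>i\<in>I. \<bar>a i\<bar> powr p) = (\<Sum>k<card I. \<bar>a (h k)\<bar> powr p)" for a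
    by (subst sum.reindex_bij_betw[OF h, symmetric]) simp
  ultimately show ?thesis
    using that[of e'] e by simp
qed

section \<open>Averaging and counting estimates\<close>

text \<open>Each residue is attained exactly \<open>u\<close> times. This lets averages of different
  lengths be rewritten as averages of one common length.\<close>

lemma sum_mod:
  fixes g :: "nat \<Rightarrow> real"
  shows "(\<Sum>i<u * s. g (i mod s)) = real u * (\<Sum>i<s. g i)"
proof -
  have "(\<Sum>i<u * s. g (i mod s)) = (\<Sum>m<u. \<Sum>i\<in>{m * s..<m * s + s}. g (i mod s))"
    by (rule sum.nat_group[symmetric])
  also have "\<dots> = (\<Sum>m<u. \<Sum>i<s. g i)"
  proof (rule sum.cong)
    fix m
    have "(\<Sum>i<s. g i) = (\<Sum>i\<in>{m * s..<m * s + s}. g (i mod s))"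
      by (rule sum.reindex_bij_witness[of _ "\<lambda>i. i - m * s" "\<lambda>i. m * s + i"]) auto
    then show "(\<Sum>i\<in>{m * s..<m * s + s}. g (i mod s)) = (\<Sum>i<s. g i)" ..
  qed simp
  finally show ?thesis by simp
qed

text \<open>This is the source of the threshold 5: the inequality fails for every smaller
  \<open>r\<close>.\<close>

lemma Suc_less_two_power: "5 \<le> r \<Longrightarrow> r + 1 < (2::nat) ^ (r - 2)"
proof (induction r rule: dec_induct)
  case (step n)
  then have "Suc n - 2 = Suc (n - 2)" by simp
  with step show ?case by simp
qed simp

text \<open>With \<open>m = 2 ^ (r - 2)\<close> and \<open>s = 2 ^ j\<close>, the exponent on the
  right is \<open>4 * m * s\<close>. The cells take a quarter of it and the Hamming ball half of it
  plus \<open>s\<close>; the last quarter must absorb \<open>r + s\<close>, which follows from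
  \<open>r + 1 < m\<close>.\<close>

lemma packing_numerics:
  assumes "5 \<le> r"
  shows "2 ^ r * (2 ^ 2 ^ (j + (r - 2)) * 2 ^ (2 ^ j + (2 ^ r div 2) * 2 ^ j))
     < ((2::nat) ^ 2 ^ r) ^ 2 ^ j"
proof -
  define m where "m = (2::nat) ^ (r - 2)"
  define s where "s = (2::nat) ^ j"
  have "(2::nat) ^ r = 2 ^ (2 + (r - 2))"
    using assms by (subst le_add_diff_inverse) auto
  also have "\<dots> = 4 * m" by (simp only: power_add m_def) simp
  finally have 4: "(2::nat) ^ r = 4 * m" .
  have 1: "r + 1 < m" "1 \<le> s"
    using Suc_less_two_power[OF assms] by (simp_all add: m_def s_def)
  have "r \<le> s * r"
    using mult_right_mono[OF 1(2), of r] by simp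
  then have "r + s < s * (r + 1) + 1"
    unfolding distrib_left by linarith
  also have "\<dots> \<le> s * m"
    using 1 mult_strict_left_mono[of "r + 1" m s] by simp
  finally have "r + (m * s + (s + (4 * m div 2) * s)) < 4 * m * s"
    by (simp add: mult.commute)
  then have "(2::nat) ^ (r + (m * s + (s + (4 * m div 2) * s))) < 2 ^ (4 * m * s)"
    by (intro power_strict_increasing) auto
  then show ?thesis
    by (simp only: 4 power_add power_mult[symmetric] flip: s_def m_def)
       (simp only: 4[symmetric] mult_ac)
qed

section \<open>The finite set with a large convex hull\<close>

text \<open>One set serves both counterexamples: norm 1 places it in the unit ball, while its
  diameter and cardinality bound its own \<open>gamma2\<close> from above.\<close>

lemma convex_hull_gamma2_large:
  fixes X :: "'a::real_vector set" and N :: "'a \<Rightarrow> real"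
  assumes p: "2 < p" and X: "contains_lp p X N" and r: "5 \<le> r"
  obtains T where "finite T" "T \<noteq> {}" "T \<subseteq> X" "\<forall>t\<in>T. N t = 1"
    "\<forall>s\<in>T. \<forall>t\<in>T. N (s - t) \<le> 2" "card T \<le> 2 ^ 2 ^ (2 * r + 1)"
    "ennreal (2 powr (real r * (3/2 - 1 / p) - 1)) \<le> gamma2_norm N (convex hull T)"
proof -
  define J :: nat where "J = 2 ^ r"
  define P :: "(nat \<times> nat) set" where "P = {..<2 ^ J} \<times> {..<2 ^ J}"
  define I where "I = {..<J} \<times> Pow P"
  \<comment> \<open>A vector with all coefficients equal to \<open>c\<close> or \<open>- c\<close>
    has norm 1. The factor combines the uniform probability on \<open>Pow P\<close> with the weight
    \<open>1 / J\<close> of each block.\<close>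
  define c where "c = real (card I) powr (- 1 / p)"
  have finP: "finite P" and finI: "finite I" by (simp_all add: P_def I_def)
  have J0: "J > 0" by (simp add: J_def)
  have card_I: "card I = J * 2 ^ card P"
    using finP by (simp add: I_def card_Pow)
  have I0: "card I > 0" using J0 by (simp add: card_I)
  have c0: "c > 0" using I0 by (simp add: c_def)
  have c_powr: "c powr p = 1 / real (card I)"
  proof -
    have "c powr p = real (card I) powr - 1" using p by (simp add: c_def powr_powr)
    then show ?thesis by (simp add: powr_minus_divide)
  qed
  obtain e :: "nat \<times> (nat \<times> nat) set \<Rightarrow> 'a"
    where e: "\<And>a. (\<Sum>k\<in>I. a k *\<^sub>R e k) \<in> X"
    "\<And>a. N (\<Sum>k\<in>I. a k *\<^sub>R e k) = (\<Sum>k\<in>I. \<bar>a k\<bar> powr p) powr (1 / p)"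
    using contains_lp_finite[OF X finI] by blast
  have N_diff: "N ((\<Sum>k\<in>I. a k *\<^sub>R e k) - (\<Sum>k\<in>I. b k *\<^sub>R e k))
      = (\<Sum>k\<in>I. \<bar>a k - b k\<bar> powr p) powr (1 / p)" for a b
    using e(2)[of "\<lambda>k. a k - b k"] by (simp add: scaleR_left_diff_distrib sum_subtractf)

  \<comment> \<open>Block \<open>j\<close> of \<open>\<tau> t\<close> is the Rademacher function
    with index \<open>t j\<close>, listed by its values on \<open>Pow P\<close>.\<close>
  define \<tau> where "\<tau> t = (\<Sum>k\<in>I. (c * rad (t (fst k)) (snd k)) *\<^sub>R e k)" for t
  define E where "E = {..<J} \<rightarrow>\<^sub>E P"
  define T where "T = \<tau> ` E"
  have finE: "finite E" using finP by (auto simp: E_def intro!: finite_PiE)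
  have P0: "P \<noteq> {}" by (auto simp: P_def lessThan_empty_iff)
  then have E0: "E \<noteq> {}" by (auto simp: E_def PiE_eq_empty_iff)
  have T_fin: "finite T" "T \<noteq> {}" using finE E0 by (simp_all add: T_def)
  have T_X: "T \<subseteq> X" using e(1) by (auto simp: T_def \<tau>_def)
  have T_1: "N t = 1" if "t \<in> T" for t
  proof -
    from that obtain u where "t = \<tau> u" by (auto simp: T_def)
    then have "N t = (\<Sum>k\<in>I. \<bar>c * rad (u (fst k)) (snd k)\<bar> powr p) powr (1 / p)"
      by (simp add: \<tau>_def e(2))
    also have "(\<Sum>k\<in>I. \<bar>c * rad (u (fst k)) (snd k)\<bar> powr p) = (\<Sum>k\<in>I. c powr p)"
      using c0 by (intro sum.cong) (auto simp: rad_def)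
    finally show ?thesis using I0 by (simp add: c_powr)
  qed
  have T_2: "N (s - t) \<le> 2" if "s \<in> T" "t \<in> T" for s t
  proof -
    from that obtain u v where "s = \<tau> u" "t = \<tau> v" by (auto simp: T_def)
    then have "N (s - t)
        = (\<Sum>k\<in>I. \<bar>c * rad (u (fst k)) (snd k) - c * rad (v (fst k)) (snd k)\<bar> powr p) powr (1 / p)"
      by (simp add: \<tau>_def N_diff)
    also have "\<dots> \<le> (\<Sum>k\<in>I. (2 * c) powr p) powr (1 / p)"
      using c0 p by (intro powr_mono2 sum_mono sum_nonneg) (auto simp: rad_def)
    also have "\<dots> = 2"
      using c0 p I0 by (simp add: powr_mult c_powr powr_powr)
    finally show ?thesis .
  qed
  have T_card: "card T \<le> 2 ^ 2 ^ (2 * r + 1)"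
  proof -
    have "card T \<le> card E" unfolding T_def using finE by (rule card_image_le)
    also have "card E = (2 ^ J * 2 ^ J) ^ J"
      by (simp add: E_def card_PiE P_def)
    also have "\<dots> = 2 ^ (2 * (J * J))"
      by (simp add: power_mult mult.assoc[symmetric] flip: power_add mult_2)
    also have "2 * (J * J) = 2 ^ (2 * r + 1)"
      by (simp add: J_def power_add mult_2)
    finally show ?thesis .
  qed

  \<comment> \<open>A member of \<open>S j\<close> picks one Rademacher function per position; the
    position is the first index, so functions at different positions are orthogonal. Block
    \<open>j\<close> of \<open>y F\<close> averages the functions picked by
    \<open>F j\<close>.\<close>
  define S where "S j = ({..<(2::nat) ^ j} \<rightarrow>\<^sub>E {..<(2::nat) ^ J})" for j :: nat
  define y where "y F = (\<Sum>k\<in>I. (c / 2 ^ fst k * (\<Sum>i<2 ^ fst k. rad (i, F (fst k) i) (snd k))) *\<^sub>R e k)"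
    for F :: "nat \<Rightarrow> nat \<Rightarrow> nat"
  have y_hull: "y F \<in> convex hull T" if F: "F \<in> Pi\<^sub>E {..<J} S" for F
  proof -
    \<comment> \<open>The point \<open>y F\<close> is the average of the \<open>2 ^ J\<close> points
      \<open>\<tau> (t i)\<close>. In block \<open>j\<close> the index runs periodically through the
      \<open>2 ^ j\<close> picks, each occurring \<open>2 ^ (J - j)\<close> times, so all blocks
      come out right at once.\<close>
    define t where "t i = restrict (\<lambda>j. (i mod 2 ^ j, F j (i mod 2 ^ j))) {..<J}" for i :: nat
    have F_less: "F j i < 2 ^ J" if "j < J" "i < 2 ^ j" for i j
      using F that by (auto simp: S_def PiE_iff)
    have "i mod 2 ^ j < 2 ^ J" if "j < J" for i j :: nat
    proof -
      have "i mod 2 ^ j < 2 ^ j" by simp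
      also have "(2::nat) ^ j \<le> 2 ^ J" using that by (intro power_increasing) auto
      finally show ?thesis .
    qed
    then have "t i \<in> E" for i
      using F_less by (auto simp: t_def E_def P_def)
    then have "(\<Sum>i<(2::nat) ^ J. (1 / 2 ^ J) *\<^sub>R \<tau> (t i)) \<in> convex hull T"
      by (intro convex_sum) (auto simp: T_def intro: hull_inc)
    also have "(\<Sum>i<(2::nat) ^ J. (1 / 2 ^ J) *\<^sub>R \<tau> (t i))
        = (\<Sum>k\<in>I. (\<Sum>i<(2::nat) ^ J. 1 / 2 ^ J * (c * rad (t i (fst k)) (snd k))) *\<^sub>R e k)"
      unfolding \<tau>_def by (simp add: scaleR_sum_right scaleR_left.sum) (rule sum.swap)
    also have "\<dots> = y F"
      unfolding y_def
    proof (rule sum.cong)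
      fix k assume "k \<in> I"
      then obtain j \<omega> where k: "k = (j, \<omega>)" "j < J" by (auto simp: I_def)
      have "(\<Sum>i<(2::nat) ^ J. rad (t i j) \<omega>)
          = (\<Sum>i<2 ^ (J - j) * (2::nat) ^ j. rad (i mod 2 ^ j, F j (i mod 2 ^ j)) \<omega>)"
        using k by (simp add: t_def flip: power_add)
      also have "\<dots> = 2 ^ (J - j) * (\<Sum>i<2 ^ j. rad (i, F j i) \<omega>)"
        by (subst sum_mod) simp
      also have "(2::real) ^ (J - j) = 2 ^ J / 2 ^ j"
        using k by (simp add: power_diff)
      finally have "(\<Sum>i<(2::nat) ^ J. rad (t i j) \<omega>) = 2 ^ J / 2 ^ j * (\<Sum>i<2 ^ j. rad (i, F j i) \<omega>)" .
      then have "(\<Sum>i<(2::nat) ^ J. 1 / 2 ^ J * (c * rad (t i j) \<omega>))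
          = c / 2 ^ j * (\<Sum>i<2 ^ j. rad (i, F j i) \<omega>)"
        by (simp flip: sum_distrib_left sum_divide_distrib)
      then show "(\<Sum>i<(2::nat) ^ J. 1 / 2 ^ J * (c * rad (t i (fst k)) (snd k))) *\<^sub>R e k
          = (c / 2 ^ fst k * (\<Sum>i<2 ^ fst k. rad (i, F (fst k) i) (snd k))) *\<^sub>R e k"
        by (simp add: k)
    qed simp
    finally show ?thesis .
  qed

  define far where "far j f g \<longleftrightarrow> 2 ^ j \<le> 2 * card {i. i < 2 ^ j \<and> f i \<noteq> g i}"
    for j and f g :: "nat \<Rightarrow> nat"
  \<comment> \<open>The distance \<open>2 powr (- j / 2)\<close> of far averages in one block,
    scaled by the block weight \<open>J powr (- 1 / p)\<close>.\<close>
  define \<delta> where "\<delta> j = real J powr (- 1 / p) * 2 powr (- real j / 2)" for j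
  have far: "\<delta> j \<le> N (y F - y G)"
    if j: "j \<in> {..<J}" and F: "F \<in> Pi\<^sub>E {..<J} S" and G: "G \<in> Pi\<^sub>E {..<J} S"
      and fg: "far j (F j) (G j)" for j F G
  proof -
    have in_P: "(i, H j i) \<in> P" if "H \<in> Pi\<^sub>E {..<J} S" "i < 2 ^ j" for H i
    proof -
      have "(2::nat) ^ j \<le> 2 ^ J" using j by (intro power_increasing) auto
      with that(2) have "i < 2 ^ J" by (rule less_le_trans)
      then show ?thesis using that j by (auto simp: P_def S_def PiE_iff)
    qed
    define D where "D \<omega> = (\<Sum>i<2 ^ j. rad (i, F j i) \<omega> - rad (i, G j i) \<omega>)" for \<omega>
    let ?a = "\<lambda>F k. c / 2 ^ fst k * (\<Sum>i<2 ^ fst k. rad (i, F (fst k) i) (snd k))"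
    have "2 ^ card P * sqrt (real (2 ^ j)) powr p \<le> (\<Sum>\<omega>\<in>Pow P. \<bar>D \<omega>\<bar> powr p)"
      unfolding D_def using finP in_P[OF F] in_P[OF G] fg p
      by (intro sum_rad_diff_powr_ge) (auto simp: far_def)
    also have "sqrt (real (2 ^ j)) = 2 powr (real j / 2)"
      by (simp add: powr_half_sqrt[symmetric] powr_powr flip: powr_realpow)
    finally have "(c / 2 ^ j) powr p * (2 ^ card P * (2 powr (real j / 2)) powr p)
        \<le> (c / 2 ^ j) powr p * (\<Sum>\<omega>\<in>Pow P. \<bar>D \<omega>\<bar> powr p)"
      by (rule mult_left_mono) simp
    also have "(c / 2 ^ j) powr p * (2 ^ card P * (2 powr (real j / 2)) powr p)
        = 2 ^ card P * c powr p * (2 powr (real j / 2) / 2 ^ j) powr p"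
      using c0 by (simp add: powr_divide)
    also have "2 powr (real j / 2) / 2 ^ j = 2 powr (- real j / 2)"
      by (simp add: powr_diff[symmetric] flip: powr_realpow)
    also have "2 ^ card P * c powr p = 1 / real J"
      by (simp add: c_powr card_I)
    also have "(c / 2 ^ j) powr p * (\<Sum>\<omega>\<in>Pow P. \<bar>D \<omega>\<bar> powr p) = (\<Sum>\<omega>\<in>Pow P. \<bar>c / 2 ^ j * D \<omega>\<bar> powr p)"
      using c0 by (simp add: sum_distrib_left abs_mult powr_mult powr_divide)
    also have "\<dots> = (\<Sum>k\<in>{j} \<times> Pow P. \<bar>?a F k - ?a G k\<bar> powr p)"
      by (rule sum.reindex_bij_witness[of _ snd "Pair j"])
        (auto simp: D_def sum_subtractf right_diff_distrib)
    \<comment> \<open>Block \<open>j\<close> alone gives the bound; the other blocks are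
      discarded.\<close>
    also have "\<dots> \<le> (\<Sum>k\<in>I. \<bar>?a F k - ?a G k\<bar> powr p)"
      using j finI by (intro sum_mono2) (auto simp: I_def)
    finally have "(1 / real J * (2 powr (- real j / 2)) powr p) powr (1 / p)
        \<le> (\<Sum>k\<in>I. \<bar>?a F k - ?a G k\<bar> powr p) powr (1 / p)"
      using p by (intro powr_mono2) auto
    also have "\<dots> = N (y F - y G)"
      by (simp only: y_def N_diff)
    also have "(1 / real J * (2 powr (- real j / 2)) powr p) powr (1 / p) = \<delta> j"
      using J0 p by (simp add: \<delta>_def powr_mult powr_powr powr_divide powr_minus_divide)
    finally show ?thesis .
  qed

  \<comment> \<open>\<open>2 ^ \<nu> j\<close> is a quarter of \<open>J * 2 ^ j\<close>, the binary
    logarithm of \<open>card (S j)\<close>. Distinct \<open>j\<close> use distinct levels, so their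
    contributions add up.\<close>
  define \<nu> where "\<nu> j = j + (r - 2)" for j
  have "ennreal (2 powr (real r * (3/2 - 1 / p) - 1)) \<le> gamma2 (convex hull T) (\<lambda>x y. N (x - y))"
  proof (rule gamma2_geI)
    fix \<A> assume adm: "admissible (convex hull T) \<A>"
    obtain F where F: "F \<in> Pi\<^sub>E {..<J} S"
      "\<And>j. j \<in> {..<J} \<Longrightarrow> ennreal (\<delta> j) \<le> ediam (\<lambda>x y. N (x - y)) (cell (\<A> (\<nu> j)) (y F))"
    proof (rule exists_point_all_cells_large[where J = "{..<J}" and S = S and y = y and \<nu> = \<nu>
          and far = far and \<delta> = \<delta> and d = "\<lambda>x y. N (x - y)"
          and b = "\<lambda>j. 2 ^ (2 ^ j + (J div 2) * 2 ^ j)", OF adm])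
      show "card {g \<in> S j. \<not> far j f g} \<le> 2 ^ (2 ^ j + (J div 2) * 2 ^ j)"
        if "f \<in> S j" for j f
        using card_hamming_ball_le[of J f "2 ^ j"] that r by (simp add: S_def far_def J_def)
      show "card {..<J} * (2 ^ 2 ^ \<nu> j * 2 ^ (2 ^ j + (J div 2) * 2 ^ j)) < card (S j)" for j
        using packing_numerics[OF r, of j] by (simp add: S_def card_PiE J_def \<nu>_def)
      show "finite (S j)" for j by (auto simp: S_def intro!: finite_PiE)
    qed (use y_hull far r in \<open>auto simp: \<nu>_def\<close>)
    \<comment> \<open>The growth of the weight in \<open>j\<close> cancels the decay of
      \<open>\<delta> j\<close>, so all \<open>J = 2 ^ r\<close> levels contribute equally.\<close>
    have term_eq: "2 powr (real (\<nu> j) / 2) * \<delta> j = 2 powr (real r / 2 - 1 - real r / p)" for j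
    proof -
      have "real J powr (- 1 / p) = 2 powr (- real r / p)"
        by (simp add: J_def powr_powr flip: powr_realpow)
      then have "2 powr (real (\<nu> j) / 2) * \<delta> j
          = 2 powr (real (\<nu> j) / 2 + (- real r / p + - real j / 2))"
        by (simp only: \<delta>_def powr_add)
      also have "real (\<nu> j) / 2 + (- real r / p + - real j / 2) = real r / 2 - 1 - real r / p"
        using r by (simp add: \<nu>_def field_simps)
      finally show ?thesis .
    qed
    have "2 powr (real r * (3/2 - 1 / p) - 1) = 2 powr real r * 2 powr (real r / 2 - 1 - real r / p)"
      unfolding powr_add[symmetric] by (simp add: algebra_simps)
    also have "\<dots> = (\<Sum>j<J. 2 powr (real (\<nu> j) / 2) * \<delta> j)"
      unfolding term_eq by (simp add: powr_realpow J_def)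
    finally have "ennreal (2 powr (real r * (3/2 - 1 / p) - 1))
        = (\<Sum>j<J. ennreal (2 powr (real (\<nu> j) / 2)) * ennreal (\<delta> j))"
      by (simp add: \<delta>_def flip: ennreal_mult)
    also have "\<dots> \<le> (\<Sum>j<J. ennreal (2 powr (real (\<nu> j) / 2)) *
        ediam (\<lambda>x y. N (x - y)) (cell (\<A> (\<nu> j)) (y F)))"
      using F(2) by (intro sum_mono mult_left_mono) auto
    also have "\<dots> \<le> (\<Sum>n. ennreal (2 powr (real n / 2)) *
        ediam (\<lambda>x y. N (x - y)) (cell (\<A> n) (y F)))"
      by (rule sum_le_suminf_ennreal) (auto simp: \<nu>_def inj_on_def)
    finally show "\<exists>x\<in>convex hull T. ennreal (2 powr (real r * (3/2 - 1 / p) - 1))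
        \<le> (\<Sum>n. ennreal (2 powr (real n / 2)) * ediam (\<lambda>x y. N (x - y)) (cell (\<A> n) x))"
      using y_hull[OF F(1)] by blast
  qed
  then show ?thesis
    using that[OF T_fin T_X _ _ T_card] T_1 T_2 by (simp add: gamma2_norm_def)
qed


section \<open>Isometric copies inside the sequence and function spaces\<close>

lemma seq_lp_contains_lp: "contains_lp p (seq_lp p) (seq_lp_norm p)"
  unfolding contains_lp_def
proof (intro allI exI)
  fix M and a :: "nat \<Rightarrow> real"
  define e :: "nat \<Rightarrow> nat \<Rightarrow> real" where "e k = (\<lambda>n. if n = k then 1 else 0)" for k
  have "(\<Sum>k<M. a k *\<^sub>R e k) n = (if n < M then a n else 0)" for n
    by (induction M) (auto simp: e_def scaleR_fun_def less_Suc_eq)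
  then have eq: "(\<Sum>k<M. a k *\<^sub>R e k) = (\<lambda>n. if n < M then a n else 0)"
    by blast
  have sums: "(\<lambda>n. \<bar>if n < M then a n else 0\<bar> powr p) sums (\<Sum>n<M. \<bar>a n\<bar> powr p)"
    using sums_finite[of "{..<M}" "\<lambda>n. \<bar>if n < M then a n else 0\<bar> powr p"] by simp
  \<comment> \<open>The witness is written out because it must be chosen before \<open>a\<close>,
    while \<open>e\<close> was introduced after \<open>a\<close> was fixed.\<close>
  show "(\<Sum>k<M. a k *\<^sub>R (\<lambda>k n. if n = k then 1 else 0) k) \<in> seq_lp p \<and>
     seq_lp_norm p (\<Sum>k<M. a k *\<^sub>R (\<lambda>k n. if n = k then 1 else 0) k)
     = (\<Sum>k<M. \<bar>a k\<bar> powr p) powr (1 / p)"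
    using eq sums_summable[OF sums] sums_unique[OF sums, symmetric]
    by (simp add: e_def seq_lp_def seq_lp_norm_def)
qed


text \<open>Half-open intervals make distinct cells disjoint everywhere, so the identity for powers
  of step functions holds pointwise.\<close>

definition grid :: "nat \<Rightarrow> nat \<Rightarrow> real set" where
  "grid M k = {real k / real M..<real (Suc k) / real M}"

lemma grid_disjoint: "M > 0 \<Longrightarrow> x \<in> grid M k \<Longrightarrow> x \<in> grid M l \<Longrightarrow> k = l"
  unfolding grid_def by (simp add: field_simps)

lemma grid_subset: "k < M \<Longrightarrow> grid M k \<subseteq> {0..1}"
proof
  fix x assume "k < M" "x \<in> grid M k"
  then have "0 \<le> real k / real M" "real k / real M \<le> x" "x < real (Suc k) / real M"
    "real (Suc k) / real M \<le> 1"
    by (auto simp: grid_def)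
  then show "x \<in> {0..1}"
    unfolding atLeastAtMost_iff by (meson order_trans less_imp_le)
qed

text \<open>At most one summand is nonzero at any point, and \<open>0 powr p = 0\<close> covers the
  points outside all cells.\<close>

lemma step_function_abs_powr:
  fixes b :: "nat \<Rightarrow> real"
  assumes "M > 0"
  shows "\<bar>\<Sum>k<M. b k * indicator (grid M k) x\<bar> powr p
     = (\<Sum>k<M. \<bar>b k\<bar> powr p * indicator (grid M k) x)"
proof (cases "\<exists>l<M. x \<in> grid M l")
  case True
  then obtain l where l: "l < M" "x \<in> grid M l" by blast
  have ind: "indicator (grid M k) x = (if k = l then 1 else 0 :: real)" for k
    using grid_disjoint[OF assms l(2), of k] l by (cases "k = l") (auto simp: indicator_def)
  have "(\<Sum>k<M. g k * indicator (grid M k) x) = (\<Sum>k<M. if k = l then g k else 0)"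
    for g :: "nat \<Rightarrow> real"
    by (intro sum.cong) (simp_all add: ind)
  then have "(\<Sum>k<M. g k * indicator (grid M k) x) = g l" for g :: "nat \<Rightarrow> real"
    using l by simp
  then show ?thesis by (simp only:)
qed (auto simp: indicator_def)

lemma step_function_integral:
  assumes "M > 0"
  shows "has_bochner_integral leb01 (\<lambda>x. \<Sum>k<M. b k * indicator (grid M k) x) ((\<Sum>k<M. b k) / real M)"
proof -
  have "has_bochner_integral leb01 (\<lambda>x. b k * indicator (grid M k) x) (b k * (1 / real M))"
    if "k < M" for k
  proof (intro has_bochner_integral_mult_right)
    have sets: "grid M k \<in> sets lebesgue"
      by (simp add: grid_def)
    have le: "real k / real M \<le> real (Suc k) / real M"
      by (intro divide_right_mono) auto
    have sub: "grid M k \<subseteq> {0..1}" using that by (rule grid_subset)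
    have "measure leb01 (grid M k) = measure lebesgue (grid M k)"
      using sub by (intro measure_restrict_space) auto
    also have "\<dots> = 1 / real M"
      using assms le by (simp add: grid_def flip: diff_divide_distrib)
    finally have *: "measure leb01 (grid M k) = 1 / real M" .
    have "has_bochner_integral leb01 (indicator (grid M k)) (measure leb01 (grid M k))"
      using sets sub le
      by (intro has_bochner_integral_real_indicator)
         (auto simp: sets_restrict_space_iff emeasure_restrict_space grid_def)
    then show "has_bochner_integral leb01 (indicator (grid M k)) (1 / real M)"
      by (simp add: *)
  qed
  then have "has_bochner_integral leb01 (\<lambda>x. \<Sum>k<M. b k * indicator (grid M k) x)
      (\<Sum>k<M. b k * (1 / real M))"
    by (intro has_bochner_integral_sum) auto
  then show ?thesis by (simp add: sum_divide_distrib)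
qed

text \<open>The indicators of \<open>M\<close> disjoint intervals of length \<open>1 / M\<close>,
  scaled by \<open>M powr (1 / p)\<close> to norm 1, play the role of the unit vectors.\<close>

lemma Lp_contains_lp:
  assumes "p > 0"
  shows "contains_lp p (Lp p) (Lp_norm p)"
  unfolding contains_lp_def
proof
  fix M :: nat
  define w where "w = real M powr (1 / p)"
  define e where "e k = abs_L0 (\<lambda>x. w * indicator (grid M k) x)" for k
  \<comment> \<open>For this partial quotient, reflexivity at \<open>f\<close> means measurability;
    it is the side condition for computing with representatives.\<close>
  have refl: "ae_eq01 f f" if "f \<in> borel_measurable leb01" for f
    using that by (simp add: ae_eq01_def)
  have meas1: "indicator (grid M k) \<in> borel_measurable leb01" for k
    by (intro borel_measurable_indicator measurable_restrict_space1)
       (auto simp: grid_def intro!: measurable_completion)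
  have meas: "(\<lambda>x. \<Sum>k<m. b k * indicator (grid M k) x) \<in> borel_measurable leb01" for m and b :: "nat \<Rightarrow> real"
    by (intro borel_measurable_sum borel_measurable_times borel_measurable_const meas1)
  have comb: "(\<Sum>k<m. a k *\<^sub>R e k) = abs_L0 (\<lambda>x. \<Sum>k<m. (a k * w) * indicator (grid M k) x)" for a m
  proof (induction m)
    case 0
    show ?case by (simp add: zero_L0_def)
  next
    case (Suc m)
    have m1: "(\<lambda>x. w * indicator (grid M m) x) \<in> borel_measurable leb01"
      "(\<lambda>x. a m * (w * indicator (grid M m) x)) \<in> borel_measurable leb01"
      using meas1 by (auto intro!: borel_measurable_times)
    have "(\<Sum>k<Suc m. a k *\<^sub>R e k)
        = abs_L0 (\<lambda>x. \<Sum>k<m. (a k * w) * indicator (grid M k) x)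
          + abs_L0 (\<lambda>x. a m * (w * indicator (grid M m) x))"
      using Suc by (simp add: e_def scaleR_L0.abs_eq[OF refl[OF m1(1)]])
    also have "\<dots> = abs_L0 (\<lambda>x. \<Sum>k<Suc m. (a k * w) * indicator (grid M k) x)"
      by (subst plus_L0.abs_eq[OF refl[OF meas] refl[OF m1(2)]]) (simp add: mult.assoc)
    finally show ?case .
  qed
  have "(\<Sum>k<M. a k *\<^sub>R e k) \<in> Lp p \<and>
     Lp_norm p (\<Sum>k<M. a k *\<^sub>R e k) = (\<Sum>k<M. \<bar>a k\<bar> powr p) powr (1 / p)" for a
  proof (cases "M = 0")
    case True
    have "integrable leb01 (\<lambda>x. \<bar>0::real\<bar> powr p)" by simp
    then have "in_Lp p 0" "Lp_norm p 0 = 0"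
      unfolding zero_L0_def
      by (simp_all add: in_Lp.abs_eq[OF refl] Lp_norm.abs_eq[OF refl])
    then show ?thesis using True by (simp add: Lp_def)
  next
    case False
    let ?f = "\<lambda>x. \<Sum>k<M. (a k * w) * indicator (grid M k) x"
    have w: "\<bar>a k * w\<bar> powr p = real M * \<bar>a k\<bar> powr p" for k
      using assms by (simp add: w_def abs_mult powr_mult powr_powr)
    have "has_bochner_integral leb01 (\<lambda>x. \<bar>?f x\<bar> powr p) ((\<Sum>k<M. \<bar>a k * w\<bar> powr p) / real M)"
      using False by (simp only: step_function_abs_powr) (rule step_function_integral, simp)
    also have "(\<Sum>k<M. \<bar>a k * w\<bar> powr p) / real M = (\<Sum>k<M. \<bar>a k\<bar> powr p)"
      using False by (simp add: w flip: sum_distrib_left)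
    finally have "has_bochner_integral leb01 (\<lambda>x. \<bar>?f x\<bar> powr p) (\<Sum>k<M. \<bar>a k\<bar> powr p)" .
    then have "integrable leb01 (\<lambda>x. \<bar>?f x\<bar> powr p)"
      "(\<integral>x. \<bar>?f x\<bar> powr p \<partial>leb01) = (\<Sum>k<M. \<bar>a k\<bar> powr p)"
      by (simp_all add: has_bochner_integral_iff)
    then show ?thesis
      by (simp only: comb Lp_def mem_Collect_eq in_Lp.abs_eq[OF refl[OF meas]]
          Lp_norm.abs_eq[OF refl[OF meas]] simp_thms)
  qed
  then show "\<exists>e. \<forall>a. (\<Sum>k<M. a k *\<^sub>R e k) \<in> Lp p \<and>
     Lp_norm p (\<Sum>k<M. a k *\<^sub>R e k) = (\<Sum>k<M. \<bar>a k\<bar> powr p) powr (1 / p)"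
    by blast
qed


section \<open>The counterexamples\<close>

text \<open>Each induction step adds two levels, each at most \<open>2 * 2 ^ r\<close>, which
  together match the growth of the bound.\<close>

lemma sum_two_powr_half_le: "(\<Sum>n<2 * r + 1. 2 powr (real n / 2)) \<le> 4 * 2 ^ r"
proof (induction r)
  case (Suc r)
  have "2 powr (real (2 * r + 1) / 2) \<le> 2 powr (real (Suc r))"
    by (intro powr_mono) auto
  also have "\<dots> = 2 * 2 ^ r"
    by (subst powr_realpow) auto
  finally have "2 powr (real (2 * r + 1) / 2) \<le> 2 * 2 ^ r" .
  moreover have "2 powr (real (2 * r + 2) / 2) = 2 * 2 ^ r"
  proof -
    have "real (2 * r + 2) / 2 = real (Suc r)" by simp
    then show ?thesis by (simp only: powr_realpow zero_less_numeral power_Suc)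
  qed
  moreover have "2 * Suc r + 1 = Suc (Suc (2 * r + 1))" by simp
  ultimately show ?case using Suc by simp
qed simp

lemma sqrt_ln_le:
  assumes "1 \<le> n" "n \<le> 2 ^ 2 ^ (2 * r + 1)"
  shows "sqrt (ln (real n)) \<le> 2 * 2 ^ r"
proof (rule real_le_lsqrt)
  have "ln (real n) \<le> ln (2 ^ 2 ^ (2 * r + 1))"
  proof (rule ln_mono)
    have "real n \<le> real (2 ^ 2 ^ (2 * r + 1))"
      using assms(2) by (simp only: of_nat_le_iff)
    then show "real n \<le> 2 ^ 2 ^ (2 * r + 1)"
      by (simp only: of_nat_power of_nat_numeral)
  qed (use assms in simp_all)
  also have "\<dots> = 2 ^ (2 * r + 1) * ln 2"
    by (simp add: ln_realpow)
  \<comment> \<open>Bounding \<open>ln 2\<close> by 2 turns the right-hand side into a perfect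
    square.\<close>
  also have "\<dots> \<le> 2 ^ (2 * r + 1) * 2"
    using ln_2_less_1 by (intro mult_left_mono) auto
  also have "\<dots> = (2 * 2 ^ r)\<^sup>2"
    by (simp add: power_add power_even_eq power_mult_distrib)
  finally show "ln (real n) \<le> (2 * 2 ^ r)\<^sup>2" .
qed simp

text \<open>The exponent \<open>3/2 - 1/p\<close> exceeds 1 by \<open>1/2 - 1/p\<close>, which is
  positive because \<open>p > 2\<close>. Dividing by \<open>2 ^ r\<close> leaves an unbounded power
  of 2.\<close>

lemma no_uniform_constant:
  assumes p: "2 < (p::real)" and K: "K < (\<infinity>::ennreal)"
  shows "\<not> (\<forall>r\<ge>5. ennreal (2 powr (real r * (3/2 - 1 / p) - 1)) \<le> K * ennreal (8 * 2 ^ r))"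
proof
  assume *: "\<forall>r\<ge>5. ennreal (2 powr (real r * (3/2 - 1 / p) - 1)) \<le> K * ennreal (8 * 2 ^ r)"
  obtain \<kappa> where \<kappa>: "K = ennreal \<kappa>" "\<kappa> \<ge> 0"
    using K by (cases K) auto
  define \<theta> where "\<theta> = 1/2 - 1 / p"
  have \<theta>: "\<theta> > 0" using p by (simp add: \<theta>_def field_simps)
  have bound: "2 powr (real r * \<theta>) \<le> 16 * \<kappa>" if "r \<ge> 5" for r
  proof -
    have "2 powr (real r * (3/2 - 1 / p) - 1) \<le> \<kappa> * (8 * 2 ^ r)"
      using *[rule_format, OF that] \<kappa> by (simp flip: ennreal_mult)
    also have "real r * (3/2 - 1 / p) - 1 = real r * \<theta> + real r - 1"
      by (simp add: \<theta>_def algebra_simps)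
    also have "2 powr \<dots> = 2 powr (real r * \<theta>) * 2 ^ r / 2"
      by (simp add: powr_add powr_diff powr_realpow)
    finally show ?thesis by (simp add: field_simps)
  qed
  obtain r :: nat where r: "log 2 (16 * \<kappa> + 1) / \<theta> < real r"
    using reals_Archimedean2 by blast
  have "16 * \<kappa> + 1 = 2 powr (log 2 (16 * \<kappa> + 1))"
    using \<kappa> by simp
  also have "\<dots> \<le> 2 powr (real (max 5 r) * \<theta>)"
  proof (intro powr_mono)
    have "log 2 (16 * \<kappa> + 1) \<le> real r * \<theta>"
      using r \<theta> by (simp add: field_simps)
    also have "\<dots> \<le> real (max 5 r) * \<theta>"
      using \<theta> by (intro mult_right_mono) auto
    finally show "log 2 (16 * \<kappa> + 1) \<le> real (max 5 r) * \<theta>" .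
  qed simp
  also have "\<dots> \<le> 16 * \<kappa>"
    by (rule bound) simp
  finally show False by simp
qed

text \<open>For the constructed \<open>T\<close>, both \<open>sqrt (ln (card T))\<close> and
  \<open>gamma2_norm N T\<close> are at most \<open>8 * 2 ^ r\<close>, so either constant would
  contradict the growth of the lower bound for the hull.\<close>

lemma gamma2_convex_hull_unbounded:
  fixes X :: "'a::real_vector set"
  assumes p: "2 < p" and X: "contains_lp p X N"
  shows "\<not> (\<exists>K::ennreal. K < \<infinity> \<and> (\<forall>T. finite T \<and> T \<noteq> {} \<and> T \<subseteq> unit_ball X N \<longrightarrow>
          gamma2_norm N (convex hull T) \<le> K * ennreal (sqrt (ln (real (card T)))))) \<and>
      \<not> (\<exists>K::ennreal. K < \<infinity> \<and> (\<forall>T. finite T \<and> T \<noteq> {} \<and> T \<subseteq> X \<longrightarrow>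
          gamma2_norm N (convex hull T) \<le> K * gamma2_norm N T))"
proof (intro conjI notI; elim exE conjE)
  fix K :: ennreal
  assume K: "K < \<infinity>" and *: "\<forall>T. finite T \<and> T \<noteq> {} \<and> T \<subseteq> unit_ball X N \<longrightarrow>
          gamma2_norm N (convex hull T) \<le> K * ennreal (sqrt (ln (real (card T))))"
  have "ennreal (2 powr (real r * (3/2 - 1 / p) - 1)) \<le> K * ennreal (8 * 2 ^ r)" if r: "r \<ge> 5" for r
  proof -
    obtain T where T: "finite T" "T \<noteq> {}" "T \<subseteq> X" "\<forall>t\<in>T. N t = 1"
      "\<forall>s\<in>T. \<forall>t\<in>T. N (s - t) \<le> 2" "card T \<le> 2 ^ 2 ^ (2 * r + 1)"
      "ennreal (2 powr (real r * (3/2 - 1 / p) - 1)) \<le> gamma2_norm N (convex hull T)"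
      using convex_hull_gamma2_large[OF p X r] by metis
    have "1 \<le> card T"
      using T(1,2) by (simp add: Suc_le_eq card_gt_0_iff)
    then have "sqrt (ln (real (card T))) \<le> 2 * 2 ^ r"
      using T(6) by (rule sqrt_ln_le)
    then have "sqrt (ln (real (card T))) \<le> 8 * 2 ^ r"
      by (rule order_trans) simp
    moreover have "T \<subseteq> unit_ball X N"
      using T(3,4) by (auto simp: unit_ball_def)
    ultimately show ?thesis
      using T(1,2,7) * by (meson ennreal_leI mult_left_mono order_trans zero_le)
  qed
  with no_uniform_constant[OF p K] show False by blast
next
  fix K :: ennreal
  assume K: "K < \<infinity>" and *: "\<forall>T. finite T \<and> T \<noteq> {} \<and> T \<subseteq> X \<longrightarrow>
          gamma2_norm N (convex hull T) \<le> K * gamma2_norm N T"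
  \<comment> \<open>The empty combination, \<open>M = 0\<close>, yields the value at zero.\<close>
  have N0: "N 0 = 0"
    using spec[OF X[unfolded contains_lp_def], of 0] by simp
  have "ennreal (2 powr (real r * (3/2 - 1 / p) - 1)) \<le> K * ennreal (8 * 2 ^ r)" if r: "r \<ge> 5" for r
  proof -
    obtain T where T: "finite T" "T \<noteq> {}" "T \<subseteq> X" "\<forall>t\<in>T. N t = 1"
      "\<forall>s\<in>T. \<forall>t\<in>T. N (s - t) \<le> 2" "card T \<le> 2 ^ 2 ^ (2 * r + 1)"
      "ennreal (2 powr (real r * (3/2 - 1 / p) - 1)) \<le> gamma2_norm N (convex hull T)"
      using convex_hull_gamma2_large[OF p X r] by metis
    have "gamma2_norm N T \<le> ennreal (\<Sum>n<2 * r + 1. 2 powr (real n / 2)) * ennreal 2"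
      unfolding gamma2_norm_def
    proof (rule gamma2_le_of_card_le[OF T(1,2,6)])
      show "N (x - x) = 0" for x by (simp only: diff_self N0)
      show "N (x - y) \<le> 2" if "x \<in> T" "y \<in> T" for x y
        using T(5) that by blast
    qed simp
    also have "\<dots> \<le> ennreal (4 * 2 ^ r) * ennreal 2"
      using sum_two_powr_half_le by (intro mult_right_mono ennreal_leI) auto
    also have "\<dots> = ennreal (8 * 2 ^ r)"
      by (subst ennreal_mult[symmetric]) auto
    finally have "gamma2_norm N T \<le> ennreal (8 * 2 ^ r)" .
    then show ?thesis
      using T(1-3,7) * by (meson mult_left_mono order_trans zero_le)
  qed
  with no_uniform_constant[OF p K] show False by blast
qed

theorem mainTheorem3:
  fixes p :: real
  assumes "2 < p"
  shows
    "(\<not> (\<exists>K::ennreal. K < \<infinity> \<and>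
        (\<forall>T. finite T \<and> T \<noteq> {} \<and> T \<subseteq> unit_ball (Lp p) (Lp_norm p) \<longrightarrow>
          gamma2_norm (Lp_norm p) (convex hull T) \<le> K * ennreal (sqrt (ln (real (card T)))))) \<and>
      \<not> (\<exists>K::ennreal. K < \<infinity> \<and>
        (\<forall>T. finite T \<and> T \<noteq> {} \<and> T \<subseteq> Lp p \<longrightarrow>
          gamma2_norm (Lp_norm p) (convex hull T) \<le> K * gamma2_norm (Lp_norm p) T))) \<and>
     (\<not> (\<exists>K::ennreal. K < \<infinity> \<and>
        (\<forall>T. finite T \<and> T \<noteq> {} \<and> T \<subseteq> unit_ball (seq_lp p) (seq_lp_norm p) \<longrightarrow>
          gamma2_norm (seq_lp_norm p) (convex hull T) \<le> K * ennreal (sqrt (ln (real (card T)))))) \<and>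
      \<not> (\<exists>K::ennreal. K < \<infinity> \<and>
        (\<forall>T. finite T \<and> T \<noteq> {} \<and> T \<subseteq> seq_lp p \<longrightarrow>
          gamma2_norm (seq_lp_norm p) (convex hull T) \<le> K * gamma2_norm (seq_lp_norm p) T)))"
  using gamma2_convex_hull_unbounded[OF assms Lp_contains_lp]
    gamma2_convex_hull_unbounded[OF assms seq_lp_contains_lp] assms by simp

end
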